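(* Consider the setting of the modular convex Nash equilibrium problem (the spaces $\mathcal{H}_i,\mathcal{G}_k,\boldsymbol{\mathcal{H}},\boldsymbol{\mathcal{G}}$, the functions $\varphi_i,\boldsymbol{f}_i,g_k$, and the operators $\boldsymbol{L}_k,\boldsymbol{G}$, with assumptions [a]–[c]) described in the context. For every $i\in I$, set $\Pi_i\colon\boldsymbol{\mathcal{H}}\to\mathcal{H}_i\colon\boldsymbol{x}\mapsto x_i$. Suppose that $(\overline{\boldsymbol{x}},\overline{\boldsymbol{v}}^* )\in\boldsymbol{\mathcal{H}}\oplus\boldsymbol{\mathcal{G}}$ satisfies $$\begin{cases}(\forall i\in I)\;\;-\nabla_i\boldsymbol{f}_i(\overline{\boldsymbol{x}})-\sum_{k\in K}\Pi_i(\boldsymbol{L}_k^*\overline{v}_k^* )\in\partial\varphi_i(\overline{x}_i)\\(\forall k\in K)\;\;\boldsymbol{L}_k\overline{\boldsymbol{x}}\in\partial g_k^*(\overline{v}_k^* ).\end{cases}$$ Then $\overline{\boldsymbol{x}}$ solves the modular convex Nash equilibrium problem, that is, $$(\forall i\in I)\quad\overline{x}_i\in\operatorname{Argmin}\Big(\varphi_i+\boldsymbol{f}_i(\,\cdot\,;\overline{\boldsymbol{x}}_{\smallsetminus i})+\sum_{k\in K}(g_k\circ\boldsymbol{L}_k)(\,\cdot\,;\overline{\boldsymbol{x}}_{\smallsetminus i})\Big).$$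
   Context: **Setting (modular convex Nash equilibrium problem).** Let $I=\{1,\ldots,p\}$ and let $K$ be a finite set. Let $(\mathcal{H}_i)_{i\in I}$ and $(\mathcal{G}_k)_{k\in K}$ be finite families of real Hilbert spaces, and let $\boldsymbol{\mathcal{H}}=\bigoplus_{i\in I}\mathcal{H}_i$ and $\boldsymbol{\mathcal{G}}=\bigoplus_{k\in K}\mathcal{G}_k$ be their Hilbert direct sums. Generic elements are written $\boldsymbol{x}=(x_i)_{i\in I}\in\boldsymbol{\mathcal{H}}$ and $\boldsymbol{v}^*=(v_k^* )_{k\in K}\in\boldsymbol{\mathcal{G}}$. For $i\in I$ and $\boldsymbol{x}\in\boldsymbol{\mathcal{H}}$, $\boldsymbol{x}_{\smallsetminus i}=(x_j)_{j\in I\smallsetminus\{i\}}$; for $x_i\in\mathcal{H}_i$ and $\boldsymbol{y}\in\boldsymbol{\mathcal{H}}$, $(x_i;\boldsymbol{y}_{\smallsetminus i})=(y_1,\ldots,y_{i-1},x_i,y_{i+1},\ldots,y_p)$. For a function $\boldsymbol{h}$ on $\boldsymbol{\mathcal{H}}$, $\boldsymbol{h}(\,\cdot\,;\boldsymbol{x}_{\smallsetminus i})$ is the function $x_i'\mapsto\boldsymbol{h}(x_i';\boldsymbol{x}_{\smallsetminus i})$ on $\mathcal{H}_i$. $\Gamma_0(\mathcal{H})$ denotes the class of lower semicontinuous convex functions $\varphi\colon\mathcal{H}\to\,]-\infty,+\infty]$ on a real Hilbert space $\mathcal{H}$ which are proper, i.e., $\operatorname{dom}\varphi=\{x\in\mathcal{H}\mid\varphi(x)<+\infty\}\neq\varnothing$.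 The following are assumed: - [a] For every $i\in I$, $\varphi_i\in\Gamma_0(\mathcal{H}_i)$. - [b] For every $i\in I$, $\boldsymbol{f}_i\colon\boldsymbol{\mathcal{H}}\to\mathbb{R}$ is such that, for every $\boldsymbol{x}\in\boldsymbol{\mathcal{H}}$, $\boldsymbol{f}_i(\,\cdot\,;\boldsymbol{x}_{\smallsetminus i})\colon\mathcal{H}_i\to\mathbb{R}$ is convex and differentiable, and its gradient at $x_i$ is denoted by $\nabla_i\boldsymbol{f}_i(\boldsymbol{x})$. Further, the operator $\boldsymbol{G}\colon\boldsymbol{\mathcal{H}}\to\boldsymbol{\mathcal{H}}\colon\boldsymbol{x}\mapsto(\nabla_i\boldsymbol{f}_i(\boldsymbol{x}))_{i\in I}$ is monotone and Lipschitzian. - [c] For every $k\in K$, $g_k\in\Gamma_0(\mathcal{G}_k)$ and $\boldsymbol{L}_k\colon\boldsymbol{\mathcal{H}}\to\mathcal{G}_k$ is linear and bounded. The problem is to find $\boldsymbol{x}\in\boldsymbol{\mathcal{H}}$ such that, for every $i\in I$, $x_i\in\operatorname{Argmin}\big(\varphi_i+\boldsymbol{f}_i(\,\cdot\,;\boldsymbol{x}_{\smallsetminus i})+\sum_{k\in K}(g_k\circ\boldsymbol{L}_k)(\,\cdot\,;\boldsymbol{x}_{\smallsetminus i})\big)$, where $\operatorname{Argmin}$ is the set of global minimizers over $\mathcal{H}_i$. **Further notation.** For $\varphi\in\Gamma_0(\mathcal{H})$: $\partial\varphi(x)=\{x^*\in\mathcal{H}\mid(\forall y\in\mathcal{H})\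 \langle y-x\mid x^*\rangle+\varphi(x)\leq\varphi(y)\}$ is the subdifferential and $\varphi^*$ is the Fenchel conjugate. $\boldsymbol{L}_k^*$ denotes the adjoint of $\boldsymbol{L}_k$. *)

theory Defs
  imports "HOL-Analysis.Analysis"
begin

text \<open>
  A finite family of unrelated Hilbert spaces cannot be typed directly, since a family has one
  element type. Each member is therefore a linear subspace of a common real inner product space
  that is complete for the induced norm. This loses no generality, because the members of a family
  of Hilbert spaces sit isometrically inside their Hilbert direct sum. Functions and operators
  are total in HOL, and every notion below is relative to the space \<open>S\<close> in question and
  ignores values outside it.
\<close>

definition hilbert_space_on :: "'a::real_inner set \<Rightarrow> bool" where
  "hilbert_space_on S \<longleftrightarrow> subspace S \<and> complete S"

text \<open>
  The inner product of \<^typ>\<open>'a ^ 'i\<close> is the sum of the componentwise inner products, so these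
  subspaces carry the Hilbert direct sum structure. Taking \<open>J\<close> to be a subset of a finite type
  allows the empty index set.
\<close>

definition direct_sum :: "'i::finite set \<Rightarrow> ('i \<Rightarrow> 'a::real_inner set) \<Rightarrow> ('a ^ 'i) set" where
  "direct_sum J H = {x. (\<forall>i\<in>J. x $ i \<in> H i) \<and> (\<forall>i. i \<notin> J \<longrightarrow> x $ i = 0)}"

text \<open>\<open>subst_comp y i x\<close> is the point \<open>(y; x\<^sub>\<setminus>\<^sub>i)\<close>.\<close>

definition subst_comp :: "'a \<Rightarrow> 'i::finite \<Rightarrow> 'a ^ 'i \<Rightarrow> 'a ^ 'i" where
  "subst_comp y i x = (\<chi> j. if j = i then y else x $ j)"

definition convex_ereal_on :: "'a::real_vector set \<Rightarrow> ('a \<Rightarrow> ereal) \<Rightarrow> bool" where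
  "convex_ereal_on S \<phi> \<longleftrightarrow>
    (\<forall>x\<in>S. \<forall>y\<in>S. \<forall>t::real. 0 < t \<and> t < 1 \<longrightarrow>
      \<phi> (t *\<^sub>R x + (1 - t) *\<^sub>R y) \<le> ereal t * \<phi> x + ereal (1 - t) * \<phi> y)"

definition lsc_on :: "'a::topological_space set \<Rightarrow> ('a \<Rightarrow> ereal) \<Rightarrow> bool" where
  "lsc_on S \<phi> \<longleftrightarrow> (\<forall>x\<in>S. \<phi> x \<le> Liminf (at x within S) \<phi>)"

definition Gamma0 :: "'a::real_inner set \<Rightarrow> ('a \<Rightarrow> ereal) set" where
  "Gamma0 S = {\<phi>. (\<forall>x\<in>S. \<phi> x \<noteq> -\<infinity>) \<and> (\<exists>x\<in>S. \<phi> x < \<infinity>) \<and>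
                  convex_ereal_on S \<phi> \<and> lsc_on S \<phi>}"

definition subdifferential :: "'a::real_inner set \<Rightarrow> ('a \<Rightarrow> ereal) \<Rightarrow> 'a \<Rightarrow> 'a set" where
  "subdifferential S \<phi> x = {u \<in> S. \<forall>y\<in>S. ereal ((y - x) \<bullet> u) + \<phi> x \<le> \<phi> y}"

definition fenchel_conjugate :: "'a::real_inner set \<Rightarrow> ('a \<Rightarrow> ereal) \<Rightarrow> 'a \<Rightarrow> ereal" where
  "fenchel_conjugate S \<phi> u = (SUP x\<in>S. ereal (x \<bullet> u) - \<phi> x)"

definition bounded_linear_on ::
  "'a::real_normed_vector set \<Rightarrow> 'b::real_normed_vector set \<Rightarrow> ('a \<Rightarrow> 'b) \<Rightarrow> bool" where
  "bounded_linear_on S T L \<longleftrightarrow>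
    L \<in> S \<rightarrow> T \<and>
    (\<forall>x\<in>S. \<forall>y\<in>S. L (x + y) = L x + L y) \<and>
    (\<forall>c. \<forall>x\<in>S. L (c *\<^sub>R x) = c *\<^sub>R L x) \<and>
    (\<exists>B. \<forall>x\<in>S. norm (L x) \<le> B * norm x)"

text \<open>
  The two definite descriptions below denote by the Riesz representation theorem when \<open>S\<close> is
  complete, \<open>L\<close> is bounded and linear on \<open>S\<close>, and \<open>h\<close> is differentiable within \<open>S\<close> at \<open>x \<in> S\<close>.
  Membership in \<open>S\<close> makes the representing vector unique.
\<close>

definition adjoint_on ::
  "'a::real_inner set \<Rightarrow> ('a \<Rightarrow> 'b::real_inner) \<Rightarrow> 'b \<Rightarrow> 'a" where
  "adjoint_on S L v = (THE u. u \<in> S \<and> (\<forall>x\<in>S. L x \<bullet> v = x \<bullet> u))"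

definition gradient_on :: "'a::real_inner set \<Rightarrow> ('a \<Rightarrow> real) \<Rightarrow> 'a \<Rightarrow> 'a" where
  "gradient_on S h x = (THE u. u \<in> S \<and> (h has_derivative (\<lambda>d. d \<bullet> u)) (at x within S))"

definition partial_gradient ::
  "('i::finite \<Rightarrow> 'a::real_inner set) \<Rightarrow> ('i \<Rightarrow> 'a ^ 'i \<Rightarrow> real) \<Rightarrow> 'i \<Rightarrow> 'a ^ 'i \<Rightarrow> 'a" where
  "partial_gradient H f i x = gradient_on (H i) (\<lambda>y. f i (subst_comp y i x)) (x $ i)"

definition pseudo_gradient ::
  "('i::finite \<Rightarrow> 'a::real_inner set) \<Rightarrow> ('i \<Rightarrow> 'a ^ 'i \<Rightarrow> real) \<Rightarrow> 'a ^ 'i \<Rightarrow> 'a ^ 'i" where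
  "pseudo_gradient H f x = (\<chi> i. partial_gradient H f i x)"

definition monotone_operator_on :: "'a::real_inner set \<Rightarrow> ('a \<Rightarrow> 'a) \<Rightarrow> bool" where
  "monotone_operator_on S A \<longleftrightarrow> (\<forall>x\<in>S. \<forall>y\<in>S. 0 \<le> (x - y) \<bullet> (A x - A y))"

definition Argmin :: "'a set \<Rightarrow> ('a \<Rightarrow> ereal) \<Rightarrow> 'a set" where
  "Argmin S F = {x. is_arg_min F (\<lambda>y. y \<in> S) x}"

end

theory Submission
  imports Defs
begin

text \<open>
  Each condition of the hypothesis is a subgradient inequality in disguise, and the solution
  property is the sum of these inequalities. Fix \<open>i\<close>, move the \<open>i\<close>-th component of \<open>x\<close> to \<open>y\<close>, and
  let \<open>w\<close> be the resulting point.

  \<^item> The primal inclusion bounds \<open>\<phi> i y\<close> from below by an affine function of \<open>y\<close>.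

  \<^item> Convexity bounds \<open>f i w\<close> from below by its linearization (\<open>convex_gradient_inequality\<close>).

  \<^item> The dual inclusion implies \<open>v\<^sub>k \<in> \<partial>g\<^sub>k (L\<^sub>k x)\<close> (\<open>subdifferential_conjugate_imp\<close>). It
  bounds \<open>g\<^sub>k (L\<^sub>k w)\<close> from below by an expression with slope
  \<open>\<langle>L\<^sub>k w - L\<^sub>k x, v\<^sub>k\<rangle> = \<langle>y - x\<^sub>i, (L\<^sub>k\<^sup>* v\<^sub>k)\<^sub>i\<rangle>\<close>.

  The slopes add up to zero, so the objective at \<open>y\<close> is at least the objective at \<open>x\<^sub>i\<close>.

  The step with content is the inversion of the subdifferential of a conjugate, usually read off
  from the Fenchel-Moreau theorem. Here it comes from the proximal point (\<open>ex_proximal_point\<close>):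
  every \<open>a\<close> can be written as \<open>p + u\<close> with \<open>u \<in> \<partial>g p\<close>. For \<open>a = q + v\<close> with \<open>q \<in> \<partial>g\<^sup>* v\<close>, monotonicity
  of \<open>\<partial>g\<^sup>*\<close> forces \<open>p = q\<close>, so that \<open>v = u \<in> \<partial>g q\<close>. The same existence result, applied to a continuous
  linear function, yields the Riesz representation theorem. That theorem ensures that the
  adjoints and gradients, which are definite descriptions, are what their names say.
\<close>

section \<open>Proximal points\<close>

lemma Gamma0_lscD:
  assumes "g \<in> Gamma0 S" "p \<in> S" "r < g p"
  obtains d where "d > 0" "\<And>z. z \<in> S \<Longrightarrow> dist z p < d \<Longrightarrow> r < g z"
proof -
  have "g p \<le> Liminf (at p within S) g"
    using assms(1,2) by (simp add: Gamma0_def lsc_on_def)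
  then have "eventually (\<lambda>z. r < g z) (at p within S)"
    using assms(3) by (simp add: le_Liminf_iff)
  then obtain d where "d > 0" "\<forall>z\<in>S. z \<noteq> p \<and> dist z p < d \<longrightarrow> r < g z"
    by (auto simp: eventually_at)
  then show thesis using assms(3) that by metis
qed

lemma Gamma0_segment:
  assumes "g \<in> Gamma0 S" "x \<in> S" "y \<in> S" "g x = ereal a" "g y = ereal b" "0 < t" "t < 1"
  shows "g (t *\<^sub>R x + (1 - t) *\<^sub>R y) \<le> ereal (t * a + (1 - t) * b)"
  using assms by (force simp: Gamma0_def convex_ereal_on_def)

lemma Gamma0_finite:
  assumes "g \<in> Gamma0 S" "z \<in> S" "g z \<noteq> \<infinity>"
  shows "g z = ereal (real_of_ereal (g z))"
  using assms by (cases "g z") (auto simp: Gamma0_def)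

text \<open>
  Near a point of its domain, a lower semicontinuous function is bounded below. Convexity along
  segments to that point turns the local bound into at most linear decrease at infinity, which a
  quadratic term outweighs.
\<close>

lemma Gamma0_cone_minorant:
  assumes g: "g \<in> Gamma0 S" and S: "subspace S"
  obtains z0 c C where "z0 \<in> S" "C \<ge> 0" "\<And>z. z \<in> S \<Longrightarrow> ereal (c - C * norm (z - z0)) \<le> g z"
proof -
  obtain z0 where z0: "z0 \<in> S" "g z0 < \<infinity>" using g by (auto simp: Gamma0_def)
  define a where "a = real_of_ereal (g z0)"
  have a: "g z0 = ereal a" using Gamma0_finite[OF g z0(1)] z0 by (simp add: a_def)
  obtain d where d: "d > 0" "\<And>z. z \<in> S \<Longrightarrow> dist z z0 < d \<Longrightarrow> ereal (a - 1) < g z"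
    using Gamma0_lscD[OF g z0(1), of "ereal (a - 1)"] a by auto
  have "ereal (a - 1 - 2 / d * norm (z - z0)) \<le> g z" if z: "z \<in> S" for z
  proof (cases "dist z z0 < d")
    case True
    have "ereal (a - 1 - 2 / d * norm (z - z0)) \<le> ereal (a - 1)" using d by simp
    also have "\<dots> \<le> g z" using d(2)[OF z True] by simp
    finally show ?thesis .
  next
    case False
    show ?thesis
    proof (cases "g z = \<infinity>")
      case False
      define b where "b = real_of_ereal (g z)"
      have b: "g z = ereal b" using Gamma0_finite[OF g z False] by (simp add: b_def)
      define n where "n = norm (z - z0)"
      have n: "n \<ge> d" using \<open>\<not> dist z z0 < d\<close> by (simp add: n_def dist_norm)
      \<comment> \<open>The point at distance \<open>d / 2\<close> from \<open>z0\<close> on the segment to \<open>z\<close> lies in the ball of the local bound.\<close>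
      define t where "t = d / (2 * n)"
      have t: "0 < t" "t < 1" using d n by (auto simp: t_def field_simps)
      let ?y = "t *\<^sub>R z + (1 - t) *\<^sub>R z0"
      have y: "?y \<in> S" using S z z0 by (simp add: subspace_add subspace_scale)
      have "?y - z0 = t *\<^sub>R (z - z0)" by (simp add: algebra_simps)
      then have "dist ?y z0 = t * n" using t by (simp add: dist_norm n_def)
      also have "\<dots> < d" using d n by (simp add: t_def)
      finally have "ereal (a - 1) < g ?y" using d(2) y by blast
      also have "\<dots> \<le> ereal (t * b + (1 - t) * a)"
        by (rule Gamma0_segment[OF g z z0(1) b a t])
      finally have "- 1 < t * (b - a)" by (simp add: algebra_simps)
      then have "- 1 / t < b - a" using t by (simp add: field_simps)
      moreover have "1 / t = 2 / d * n" using d n by (simp add: t_def)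
      ultimately show ?thesis using b by (simp add: n_def)
    qed simp
  qed
  then show thesis using that[of z0 "2 / d" "a - 1"] z0 d by simp
qed

text \<open>
  The parallelogram law, centred at \<open>a\<close>. The midpoint is kept in the form
  \<open>t *\<^sub>R x + (1 - t) *\<^sub>R y\<close> of a convex combination.
\<close>

lemma norm_midpoint_sq:
  fixes x y a :: "'a::real_inner"
  shows "(norm ((1/2) *\<^sub>R x + (1 - 1/2) *\<^sub>R y - a))\<^sup>2
    = (norm (x - a))\<^sup>2 / 2 + (norm (y - a))\<^sup>2 / 2 - (norm (x - y))\<^sup>2 / 4"
  by (simp add: power2_norm_eq_inner inner_add_left inner_add_right inner_diff_left inner_diff_right
      inner_commute field_simps)

text \<open>
  Adding the quadratic makes \<open>g\<close> bounded below, and by the parallelogram law the sum is strongly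
  convex. Hence minimizing sequences are Cauchy. Their limit exists in \<open>S\<close> by completeness and is
  a minimizer by lower semicontinuity.
\<close>

lemma ex_proximal_minimizer:
  fixes a :: "'a::real_inner"
  assumes g: "g \<in> Gamma0 S" and S: "hilbert_space_on S"
  obtains p where "p \<in> S"
    "\<And>z. z \<in> S \<Longrightarrow> g p + ereal ((norm (p - a))\<^sup>2 / 2) \<le> g z + ereal ((norm (z - a))\<^sup>2 / 2)"
proof -
  have sub: "subspace S" and comp: "complete S" using S by (auto simp: hilbert_space_on_def)
  define D where "D = {z \<in> S. g z \<noteq> \<infinity>}"
  define F where "F z = real_of_ereal (g z) + (norm (z - a))\<^sup>2 / 2" for z
  have gD: "g z = ereal (F z - (norm (z - a))\<^sup>2 / 2)" if "z \<in> D" for z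
    using that Gamma0_finite[OF g, of z] by (simp add: D_def F_def)
  have D_ne: "D \<noteq> {}" using g by (force simp: Gamma0_def D_def)
  obtain z0 c C where C: "C \<ge> 0" and low: "\<And>z. z \<in> S \<Longrightarrow> ereal (c - C * norm (z - z0)) \<le> g z"
    using Gamma0_cone_minorant[OF g sub] by metis
  have bdd: "bdd_below (F ` D)"
  proof (rule bdd_belowI2)
    fix z assume z: "z \<in> D"
    have "c - C * norm (z - z0) \<le> F z - (norm (z - a))\<^sup>2 / 2"
      using low[of z] z gD[OF z] by (simp add: D_def)
    moreover have "C * norm (z - z0) \<le> C * norm (z - a) + C * norm (a - z0)"
      using C norm_triangle_ineq[of "z - a" "a - z0"]
      by (simp flip: distrib_left add: mult_left_mono)
    \<comment> \<open>Completing the square absorbs the linear decrease of slope \<open>C\<close>.\<close>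
    moreover have "0 \<le> (norm (z - a) - C)\<^sup>2" by simp
    ultimately show "c - C * norm (a - z0) - C\<^sup>2 / 2 \<le> F z"
      by (simp add: power2_eq_square algebra_simps)
  qed
  define m where "m = Inf (F ` D)"
  have m_le: "m \<le> F z" if "z \<in> D" for z
    unfolding m_def using bdd that by (simp add: cInf_lower)
  have "\<exists>z\<in>D. F z < m + e" if "e > 0" for e
    using cInf_lessD[of "F ` D" "m + e"] D_ne that by (auto simp: m_def)
  then have "\<forall>n. \<exists>z\<in>D. F z < m + 1 / real (Suc n)" by simp
  then obtain s where s: "\<And>n. s n \<in> D" "\<And>n. F (s n) < m + 1 / real (Suc n)" by metis
  \<comment> \<open>Compare the value at the midpoint, which is at least \<open>m\<close>, with the values at \<open>x\<close> and \<open>y\<close>.\<close>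
  have sq: "(norm (x - y))\<^sup>2 \<le> 4 * (F x - m) + 4 * (F y - m)" if "x \<in> D" "y \<in> D" for x y
  proof -
    let ?w = "(1/2) *\<^sub>R x + (1 - 1/2) *\<^sub>R y"
    have xy: "x \<in> S" "y \<in> S" using that by (auto simp: D_def)
    have g_le: "g ?w \<le> ereal (1/2 * (F x - (norm (x - a))\<^sup>2 / 2)
        + (1 - 1/2) * (F y - (norm (y - a))\<^sup>2 / 2))"
      by (rule Gamma0_segment[OF g xy gD[OF that(1)] gD[OF that(2)]]) auto
    moreover have "?w \<in> S" using sub xy by (simp only: subspace_add subspace_scale)
    ultimately have w: "?w \<in> D" by (auto simp: D_def)
    have "m \<le> F ?w" by (rule m_le[OF w])
    moreover have "F ?w - (norm (?w - a))\<^sup>2 / 2 \<le> 1/2 * (F x - (norm (x - a))\<^sup>2 / 2)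
        + (1 - 1/2) * (F y - (norm (y - a))\<^sup>2 / 2)"
      using g_le unfolding gD[OF w] ereal_less_eq .
    ultimately show ?thesis using norm_midpoint_sq[of x y a] by argo
  qed
  have Cau: "Cauchy s"
  proof (rule metric_CauchyI)
    fix e :: real assume e: "e > 0"
    obtain N where N: "inverse (real (Suc N)) < e\<^sup>2 / 8"
      using reals_Archimedean[of "e\<^sup>2 / 8"] e by auto
    have small: "F (s n) - m < e\<^sup>2 / 8" if "n \<ge> N" for n
    proof -
      have "F (s n) - m < 1 / real (Suc n)" using s(2)[of n] by simp
      also have "\<dots> \<le> inverse (real (Suc N))" using that by (simp add: field_simps)
      finally show ?thesis using N by simp
    qed
    show "\<exists>M. \<forall>i\<ge>M. \<forall>j\<ge>M. dist (s i) (s j) < e"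
    proof (intro exI allI impI)
      fix i j assume "i \<ge> N" "j \<ge> N"
      then have "(norm (s i - s j))\<^sup>2 < e\<^sup>2"
        using sq[OF s(1)[of i] s(1)[of j]] small[of i] small[of j] by simp
      then show "dist (s i) (s j) < e" using e by (simp add: dist_norm power2_less_imp_less)
    qed
  qed
  then obtain p where p: "p \<in> S" "s \<longlonglongrightarrow> p"
    using comp s(1) unfolding complete_def D_def by blast
  have F_lim: "(\<lambda>n. F (s n)) \<longlonglongrightarrow> m"
  proof (rule tendsto_sandwich[where f = "\<lambda>_. m" and h = "\<lambda>n. m + 1 / real (Suc n)"])
    show "(\<lambda>n. m + 1 / real (Suc n)) \<longlonglongrightarrow> m"
      using tendsto_add[OF tendsto_const[of m] LIMSEQ_inverse_real_of_nat] by (simp add: inverse_eq_divide)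
    show "\<forall>\<^sub>F n in sequentially. F (s n) \<le> m + 1 / real (Suc n)" using s(2) by (simp add: less_imp_le)
    show "\<forall>\<^sub>F n in sequentially. m \<le> F (s n)" using m_le s(1) by simp
  qed simp
  \<comment> \<open>If \<open>g p\<close> were larger, a real \<open>r\<close> strictly between the two would eventually bound \<open>g (s n)\<close> from below,
    and the limit of \<open>F (s n)\<close> would exceed \<open>m\<close>. The value \<open>g p = \<infinity>\<close> is excluded in the same way.\<close>
  have gp: "g p \<le> ereal (m - (norm (p - a))\<^sup>2 / 2)"
  proof (rule ccontr)
    assume "\<not> ?thesis"
    then have "ereal (m - (norm (p - a))\<^sup>2 / 2) < g p" by simp
    then obtain r where r: "ereal (m - (norm (p - a))\<^sup>2 / 2) < ereal r" "ereal r < g p"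
      using ereal_dense2 by blast
    obtain d where d: "d > 0" "\<And>z. z \<in> S \<Longrightarrow> dist z p < d \<Longrightarrow> ereal r < g z"
      using Gamma0_lscD[OF g p(1) r(2)] by blast
    have "\<forall>\<^sub>F n in sequentially. r + (norm (s n - a))\<^sup>2 / 2 \<le> F (s n)"
      using tendstoD[OF p(2) d(1)]
    proof eventually_elim
      case (elim n)
      have "s n \<in> S" using s(1)[of n] by (simp add: D_def)
      then show ?case using d(2)[OF _ elim] gD[OF s(1)[of n]] by simp
    qed
    moreover have "(\<lambda>n. r + (norm (s n - a))\<^sup>2 / 2) \<longlonglongrightarrow> r + (norm (p - a))\<^sup>2 / 2"
      by (intro tendsto_intros p(2)) auto
    ultimately have "r + (norm (p - a))\<^sup>2 / 2 \<le> m"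
      using tendsto_le[OF _ F_lim] by simp
    then show False using r(1) by simp
  qed
  show thesis
  proof (rule that[OF p(1)])
    fix z assume z: "z \<in> S"
    have "g p + ereal ((norm (p - a))\<^sup>2 / 2) \<le> ereal (m - (norm (p - a))\<^sup>2 / 2) + ereal ((norm (p - a))\<^sup>2 / 2)"
      using gp by (rule add_right_mono)
    also have "\<dots> = ereal m" by simp
    also have "\<dots> \<le> g z + ereal ((norm (z - a))\<^sup>2 / 2)"
    proof (cases "z \<in> D")
      case True
      then show ?thesis using m_le[OF True] by (simp add: gD)
    next
      case False
      then show ?thesis using z by (simp add: D_def)
    qed
    finally show "g p + ereal ((norm (p - a))\<^sup>2 / 2) \<le> g z + ereal ((norm (z - a))\<^sup>2 / 2)" .
  qed
qed

text \<open>
  The optimality condition of the proximal minimization: comparing \<open>p\<close> with points of the segment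
  from \<open>p\<close> to \<open>z\<close> gives the subgradient inequality up to a term linear in the step \<open>t\<close>, which vanishes
  in the limit.
\<close>

lemma ex_proximal_point:
  assumes g: "g \<in> Gamma0 S" and S: "hilbert_space_on S" and a: "a \<in> S"
  obtains p where "p \<in> S" "g p \<noteq> \<infinity>" "a - p \<in> subdifferential S g p"
proof -
  have sub: "subspace S" using S by (simp add: hilbert_space_on_def)
  obtain p where p: "p \<in> S" and
    min: "\<And>z. z \<in> S \<Longrightarrow> g p + ereal ((norm (p - a))\<^sup>2 / 2) \<le> g z + ereal ((norm (z - a))\<^sup>2 / 2)"
    using ex_proximal_minimizer[OF g S] by blast
  obtain z1 where "z1 \<in> S" "g z1 < \<infinity>" using g by (auto simp: Gamma0_def)
  then have fin: "g p \<noteq> \<infinity>" using min[of z1] by auto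
  define b where "b = real_of_ereal (g p)"
  have b: "g p = ereal b" using Gamma0_finite[OF g p fin] by (simp add: b_def)
  have "ereal ((z - p) \<bullet> (a - p)) + g p \<le> g z" if z: "z \<in> S" for z
  proof (cases "g z = \<infinity>")
    case False
    define c where "c = real_of_ereal (g z)"
    have c: "g z = ereal c" using Gamma0_finite[OF g z False] by (simp add: c_def)
    have ineq: "(z - p) \<bullet> (a - p) + b - c \<le> t * ((norm (z - p))\<^sup>2 / 2)" if t: "0 < t" "t < 1" for t
    proof -
      let ?y = "t *\<^sub>R z + (1 - t) *\<^sub>R p"
      have y: "?y \<in> S" using sub z p by (simp add: subspace_add subspace_scale)
      have "ereal (b + (norm (p - a))\<^sup>2 / 2) \<le> g ?y + ereal ((norm (?y - a))\<^sup>2 / 2)"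
        using min[OF y] b by simp
      also have "\<dots> \<le> ereal (t * c + (1 - t) * b) + ereal ((norm (?y - a))\<^sup>2 / 2)"
        by (intro add_right_mono Gamma0_segment[OF g z p c b t])
      finally have "b + (norm (p - a))\<^sup>2 / 2 \<le> t * c + (1 - t) * b + (norm (?y - a))\<^sup>2 / 2"
        by simp
      moreover have "(norm (?y - a))\<^sup>2 =
          (norm (p - a))\<^sup>2 - 2 * t * ((z - p) \<bullet> (a - p)) + t\<^sup>2 * (norm (z - p))\<^sup>2"
        unfolding power2_norm_eq_inner by (simp add: algebra_simps inner_commute power2_eq_square)
      ultimately have "t * ((z - p) \<bullet> (a - p) + b - c) \<le> t * (t * ((norm (z - p))\<^sup>2 / 2))"
        by (simp add: algebra_simps power2_eq_square)
      then show ?thesis using t by simp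
    qed
    have "(z - p) \<bullet> (a - p) + b - c \<le> 0"
    proof (rule tendsto_lowerbound)
      show "((\<lambda>t. t * ((norm (z - p))\<^sup>2 / 2)) \<longlongrightarrow> 0) (at_right 0)"
        by (rule tendsto_eq_intros refl)+ simp
      show "\<forall>\<^sub>F t in at_right 0. (z - p) \<bullet> (a - p) + b - c \<le> t * ((norm (z - p))\<^sup>2 / 2)"
        using ineq by (auto simp: eventually_at_right_field intro!: exI[of _ 1])
    qed simp
    then show ?thesis using b c by simp
  qed simp
  then have "a - p \<in> subdifferential S g p"
    using sub a p by (simp add: subdifferential_def subspace_diff)
  then show thesis using that p fin by blast
qed

section \<open>Inverting the subdifferential of the conjugate\<close>

text \<open>
  Decompose \<open>q + v = p + w\<close> with \<open>w \<in> \<partial>g p\<close>. Then \<open>g\<^sup>* w \<le> \<langle>p, w\<rangle> - g p\<close>, and \<open>g\<^sup>* v \<ge> \<langle>p, v\<rangle> - g p\<close>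
  always holds. Together with the subgradient inequality of \<open>g\<^sup>*\<close> at \<open>v\<close>, tested at \<open>w\<close>, this says that
  \<open>\<langle>w - v, q - p\<rangle> \<le> 0\<close>. But \<open>w - v = q - p\<close>, hence \<open>p = q\<close> and \<open>w = v\<close>.
\<close>

lemma subdifferential_conjugate_imp:
  assumes g: "g \<in> Gamma0 S" and S: "hilbert_space_on S" and v: "v \<in> S"
    and q: "q \<in> subdifferential S (fenchel_conjugate S g) v"
  shows "v \<in> subdifferential S g q"
proof -
  have qS: "q \<in> S" using q by (simp add: subdifferential_def)
  then have aS: "q + v \<in> S" using S v by (simp add: hilbert_space_on_def subspace_add)
  obtain p where p: "p \<in> S" "g p \<noteq> \<infinity>" "q + v - p \<in> subdifferential S g p"
    using ex_proximal_point[OF g S aS] by blast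
  define w where "w = q + v - p"
  define b where "b = real_of_ereal (g p)"
  have b: "g p = ereal b" using Gamma0_finite[OF g p(1,2)] by (simp add: b_def)
  have wS: "w \<in> S" and w: "\<And>z. z \<in> S \<Longrightarrow> ereal ((z - p) \<bullet> w + b) \<le> g z"
    using p(3) b by (auto simp: subdifferential_def w_def)
  have "fenchel_conjugate S g w \<le> ereal (p \<bullet> w - b)"
    unfolding fenchel_conjugate_def
  proof (rule SUP_least)
    fix z assume z: "z \<in> S"
    show "ereal (z \<bullet> w) - g z \<le> ereal (p \<bullet> w - b)"
      using w[OF z] by (cases "g z") (auto simp: inner_diff_left)
  qed
  moreover have "ereal (p \<bullet> v - b) \<le> fenchel_conjugate S g v"
    unfolding fenchel_conjugate_def using p(1) b by (intro SUP_upper2[of p]) auto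
  moreover have "ereal ((w - v) \<bullet> q) + fenchel_conjugate S g v \<le> fenchel_conjugate S g w"
    using q wS by (simp add: subdifferential_def)
  ultimately have "ereal ((w - v) \<bullet> q) + ereal (p \<bullet> v - b) \<le> ereal (p \<bullet> w - b)"
    by (meson add_left_mono order_trans)
  then have "(q - p) \<bullet> (q - p) \<le> 0"
    by (simp add: w_def algebra_simps inner_commute)
  then have "q = p" by (metis inner_gt_zero_iff leD right_minus_eq)
  then show ?thesis using p(3) by simp
qed

section \<open>Riesz representation, adjoints and gradients\<close>

text \<open>
  The proximal point \<open>p\<close> of \<open>-l\<close> at the origin, that is, the minimizer of \<open>\<parallel>z\<parallel>\<^sup>2 / 2 - l z\<close>, represents \<open>l\<close>:
  the inclusion \<open>-p \<in> \<partial>(-l) p\<close> says that \<open>l d \<le> \<langle>d, p\<rangle>\<close> for every direction \<open>d\<close>, and replacing \<open>d\<close> by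
  \<open>-d\<close> gives equality.
\<close>

lemma riesz_on:
  fixes S :: "'a::real_inner set" and l :: "'a \<Rightarrow> real"
  assumes S: "hilbert_space_on S" and l: "bounded_linear_on S UNIV l"
  obtains u where "u \<in> S" "\<And>x. x \<in> S \<Longrightarrow> l x = x \<bullet> u"
proof -
  have sub: "subspace S" using S by (simp add: hilbert_space_on_def)
  have add: "\<And>x y. x \<in> S \<Longrightarrow> y \<in> S \<Longrightarrow> l (x + y) = l x + l y"
    and scale: "\<And>c x. x \<in> S \<Longrightarrow> l (c *\<^sub>R x) = c * l x"
    using l by (auto simp: bounded_linear_on_def)
  obtain B where B: "\<And>x. x \<in> S \<Longrightarrow> norm (l x) \<le> B * norm x"
    using l unfolding bounded_linear_on_def by blast
  have diff: "l (x - y) = l x - l y" if "x \<in> S" "y \<in> S" for x y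
    using add[of "x - y" y] sub that by (simp add: subspace_diff)
  let ?g = "\<lambda>x. ereal (- l x)"
  have "lsc_on S ?g"
    unfolding lsc_on_def
  proof
    fix x assume x: "x \<in> S"
    have "((\<lambda>y. l y - l x) \<longlongrightarrow> 0) (at x within S)"
    proof (rule Lim_null_comparison)
      show "\<forall>\<^sub>F y in at x within S. norm (l y - l x) \<le> B * norm (y - x)"
        unfolding eventually_at_filter
        using B diff x sub by (intro always_eventually) (metis subspace_diff)
      show "((\<lambda>y. B * norm (y - x)) \<longlongrightarrow> 0) (at x within S)"
        by (rule tendsto_eq_intros refl)+ simp
    qed
    then have lim: "(?g \<longlongrightarrow> ?g x) (at x within S)"
      by (intro tendsto_intros) (simp add: LIM_zero_iff)
    show "?g x \<le> Liminf (at x within S) ?g"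
    \<comment> \<open>The filter is trivial when \<open>S\<close> is the zero space; the lower limit is then \<open>\<infinity>\<close>.\<close>
    proof (cases "at x within S = bot")
      case False
      then show ?thesis using lim_imp_Liminf[OF _ lim] by simp
    qed simp
  qed
  moreover have "convex_ereal_on S ?g"
    using sub by (auto simp: convex_ereal_on_def add scale subspace_scale)
  ultimately have "?g \<in> Gamma0 S"
    using subspace_0[OF sub] by (auto simp: Gamma0_def)
  then obtain p where p: "p \<in> S" "0 - p \<in> subdifferential S ?g p"
    using ex_proximal_point[OF _ S subspace_0[OF sub]] by blast
  have le: "l d \<le> d \<bullet> p" if d: "d \<in> S" for d
  proof -
    have "p + d \<in> S" using sub p d by (simp add: subspace_add)
    then show ?thesis using p d by (auto simp: subdifferential_def add dest!: bspec[of _ _ "p + d"])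
  qed
  have "l d = d \<bullet> p" if d: "d \<in> S" for d
    using le[OF d] le[of "- d"] scale[OF d, of "- 1"] sub d by (simp add: subspace_neg)
  then show thesis using that p by blast
qed

lemma adjoint_on_works:
  assumes S: "hilbert_space_on S" and L: "bounded_linear_on S T L"
  shows "adjoint_on S L v \<in> S \<and> (\<forall>x\<in>S. L x \<bullet> v = x \<bullet> adjoint_on S L v)"
proof -
  obtain B where B: "\<And>x. x \<in> S \<Longrightarrow> norm (L x) \<le> B * norm x"
    using L unfolding bounded_linear_on_def by blast
  have "norm (L x \<bullet> v) \<le> B * norm v * norm x" if "x \<in> S" for x
  proof -
    have "norm (L x \<bullet> v) \<le> norm (L x) * norm v" by (simp add: Cauchy_Schwarz_ineq2)
    also have "\<dots> \<le> B * norm x * norm v" using B[OF that] by (simp add: mult_right_mono)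
    finally show ?thesis by (simp add: mult_ac)
  qed
  then have "bounded_linear_on S UNIV (\<lambda>x. L x \<bullet> v)"
    using L unfolding bounded_linear_on_def by (auto simp: inner_add_left)
  then obtain u where u: "u \<in> S" "\<And>x. x \<in> S \<Longrightarrow> L x \<bullet> v = x \<bullet> u"
    using riesz_on[OF S] by blast
  show ?thesis
    unfolding adjoint_on_def
  proof (rule theI[where a = u])
    fix u' assume u': "u' \<in> S \<and> (\<forall>x\<in>S. L x \<bullet> v = x \<bullet> u')"
    have "u' - u \<in> S" using S u u' by (simp add: hilbert_space_on_def subspace_diff)
    then have "(u' - u) \<bullet> (u' - u) = 0" using u u' by (simp add: inner_diff_right)
    then show "u' = u" by simp
  qed (use u in auto)
qed

text \<open>
  The line \<open>x + t d\<close> stays in the subspace \<open>S\<close>, so a derivative within \<open>S\<close>, whose behaviour off \<open>S\<close>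
  is unconstrained, still gives an ordinary two-sided derivative along it.
\<close>

lemma derivative_on_line:
  fixes h :: "'a::real_inner \<Rightarrow> real"
  assumes S: "subspace S" and x: "x \<in> S" and d: "d \<in> S"
    and h: "(h has_derivative (\<lambda>d. d \<bullet> u)) (at x within S)"
  shows "((\<lambda>t. h (x + t *\<^sub>R d)) has_field_derivative d \<bullet> u) (at 0)"
proof -
  let ?c = "\<lambda>t. x + t *\<^sub>R d"
  have "(?c has_derivative (\<lambda>t. t *\<^sub>R d)) (at 0)"
    by (rule derivative_eq_intros refl)+ simp
  moreover have "range ?c \<subseteq> S" using S x d by (auto simp: subspace_add subspace_scale)
  then have "(h has_derivative (\<lambda>d. d \<bullet> u)) (at (?c 0) within range ?c)"
    using h by (auto intro: has_derivative_subset)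
  ultimately have "((\<lambda>t. h (?c t)) has_derivative (\<lambda>t. (t *\<^sub>R d) \<bullet> u)) (at 0)"
    by (rule has_derivative_in_compose)
  then show ?thesis by (simp add: has_field_derivative_def mult.commute[of _ "d \<bullet> u"])
qed

lemma gradient_on_works:
  fixes h :: "'a::real_inner \<Rightarrow> real"
  assumes S: "hilbert_space_on S" and x: "x \<in> S" and h: "h differentiable (at x within S)"
  shows "gradient_on S h x \<in> S \<and>
    (h has_derivative (\<lambda>d. d \<bullet> gradient_on S h x)) (at x within S)"
proof -
  have sub: "subspace S" using S by (simp add: hilbert_space_on_def)
  obtain D where D: "(h has_derivative D) (at x within S)" using h by (auto simp: differentiable_def)
  then have bl: "bounded_linear D" by (rule has_derivative_bounded_linear)
  have "bounded_linear_on S UNIV D"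
    unfolding bounded_linear_on_def
    using bounded_linear.bounded[OF bl] bounded_linear.linear[OF bl]
    by (auto simp: linear_add linear_scale mult.commute)
  then obtain u where u: "u \<in> S" "\<And>x. x \<in> S \<Longrightarrow> D x = x \<bullet> u"
    using riesz_on[OF S] by blast
  \<comment> \<open>\<open>D\<close> and \<open>\<lambda>d. d \<bullet> u\<close> agree only on \<open>S\<close>, but increments between points of \<open>S\<close> are all that
    the derivative within \<open>S\<close> sees.\<close>
  have Du: "(h has_derivative (\<lambda>d. d \<bullet> u)) (at x within S)"
  proof -
    have "((\<lambda>y. (h y - h x - (y - x) \<bullet> u) /\<^sub>R norm (y - x)) \<longlongrightarrow> 0) (at x within S)"
    proof (rule Lim_transform_eventually)
      show "((\<lambda>y. (h y - h x - D (y - x)) /\<^sub>R norm (y - x)) \<longlongrightarrow> 0) (at x within S)"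
        using D by (simp add: has_derivative_at_within)
      show "\<forall>\<^sub>F y in at x within S. (h y - h x - D (y - x)) /\<^sub>R norm (y - x)
          = (h y - h x - (y - x) \<bullet> u) /\<^sub>R norm (y - x)"
        unfolding eventually_at_filter
        using u(2) x sub by (intro always_eventually) (simp add: subspace_diff)
    qed
    then show ?thesis by (simp add: has_derivative_at_within bounded_linear_inner_left)
  qed
  show ?thesis
    unfolding gradient_on_def
  proof (rule theI[where a = u])
    fix u' assume u': "u' \<in> S \<and> (h has_derivative (\<lambda>d. d \<bullet> u')) (at x within S)"
    define d where "d = u' - u"
    have d: "d \<in> S" using sub u u' by (simp add: d_def subspace_diff)
    have "d \<bullet> u' = d \<bullet> u"
      using derivative_on_line[OF sub x d] Du u' DERIV_unique by blast
    then have "d \<bullet> d = 0" by (simp add: d_def inner_diff_right)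
    then show "u' = u" by (simp add: d_def)
  qed (use u Du in auto)
qed

text \<open>
  Restricted to the line through \<open>x\<close> and \<open>y\<close>, this is the fact that a convex function of one real
  variable lies above its tangents.
\<close>

lemma convex_gradient_inequality:
  fixes h :: "'a::real_inner \<Rightarrow> real"
  assumes S: "hilbert_space_on S" and x: "x \<in> S" and y: "y \<in> S"
    and cvx: "convex_on S h" and h: "h differentiable (at x within S)"
  shows "h x + (y - x) \<bullet> gradient_on S h x \<le> h y"
proof -
  have sub: "subspace S" using S by (simp add: hilbert_space_on_def)
  let ?\<psi> = "\<lambda>t. h (x + t *\<^sub>R (y - x))"
  have d: "y - x \<in> S" using sub x y by (simp add: subspace_diff)
  have "convex_on UNIV ?\<psi>"
  proof (rule convex_onI)
    fix t s r :: real assume t: "0 < t" "t < 1"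
    have S_line: "x + s *\<^sub>R (y - x) \<in> S" for s using sub x d by (simp add: subspace_add subspace_scale)
    have "x + ((1 - t) *\<^sub>R s + t *\<^sub>R r) *\<^sub>R (y - x)
        = (1 - t) *\<^sub>R (x + s *\<^sub>R (y - x)) + t *\<^sub>R (x + r *\<^sub>R (y - x))"
      by (simp add: algebra_simps)
    then show "?\<psi> ((1 - t) *\<^sub>R s + t *\<^sub>R r) \<le> (1 - t) * ?\<psi> s + t * ?\<psi> r"
      using convex_onD[OF cvx, of t "x + s *\<^sub>R (y - x)" "x + r *\<^sub>R (y - x)"] t S_line by simp
  qed simp
  moreover have "(?\<psi> has_field_derivative (y - x) \<bullet> gradient_on S h x) (at 0)"
    using derivative_on_line[OF sub x d] gradient_on_works[OF S x h] by blast
  ultimately have "(y - x) \<bullet> gradient_on S h x * (1 - 0) \<le> ?\<psi> 1 - ?\<psi> 0"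
    by (intro convex_on_imp_above_tangent[of UNIV]) auto
  then show ?thesis by simp
qed

section \<open>Direct sums and single-component changes\<close>

lemma subspace_direct_sum:
  assumes "\<And>i. subspace (H i)"
  shows "subspace (direct_sum J H)"
  using assms by (auto simp: subspace_def direct_sum_def)

lemma hilbert_space_on_direct_sum:
  assumes H: "\<And>i. hilbert_space_on (H i)"
  shows "hilbert_space_on (direct_sum UNIV H)"
  unfolding hilbert_space_on_def
proof
  show "subspace (direct_sum UNIV H)"
    using H by (intro subspace_direct_sum) (simp add: hilbert_space_on_def)
  show "complete (direct_sum UNIV H)"
    unfolding complete_def
  proof (intro allI impI)
    fix s assume s: "(\<forall>n. s n \<in> direct_sum UNIV H) \<and> Cauchy s"
    have "\<exists>l\<in>H i. (\<lambda>n. s n $ i) \<longlonglongrightarrow> l" for i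
    proof -
      have "\<forall>n. s n $ i \<in> H i" using s by (simp add: direct_sum_def)
      moreover have "Cauchy (\<lambda>n. s n $ i)" using s by (simp add: Cauchy_vec_nth)
      ultimately show ?thesis using H[of i] unfolding hilbert_space_on_def complete_def
        by (metis (no_types, lifting))
    qed
    then obtain l where l: "\<And>i. l i \<in> H i" "\<And>i. (\<lambda>n. s n $ i) \<longlonglongrightarrow> l i" by metis
    have "s \<longlonglongrightarrow> (\<chi> i. l i)" by (rule vec_tendstoI) (simp add: l(2))
    moreover have "(\<chi> i. l i) \<in> direct_sum UNIV H" using l(1) by (simp add: direct_sum_def)
    ultimately show "\<exists>l\<in>direct_sum UNIV H. s \<longlonglongrightarrow> l" by blast
  qed
qed

lemma subst_comp_self [simp]: "subst_comp (x $ i) i x = x"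
  by (simp add: subst_comp_def vec_eq_iff)

lemma subst_comp_in_direct_sum:
  "x \<in> direct_sum UNIV H \<Longrightarrow> y \<in> H i \<Longrightarrow> subst_comp y i x \<in> direct_sum UNIV H"
  by (simp add: subst_comp_def direct_sum_def)

lemma inner_subst_comp_diff:
  fixes x u :: "('a::real_inner) ^ 'i::finite"
  shows "(subst_comp y i x - x) \<bullet> u = (y - x $ i) \<bullet> (u $ i)"
proof -
  have "(subst_comp y i x - x) \<bullet> u = (\<Sum>j\<in>UNIV. if j = i then (y - x $ i) \<bullet> (u $ i) else 0)"
    unfolding inner_vec_def by (intro sum.cong) (auto simp: subst_comp_def)
  then show ?thesis by simp
qed

section \<open>Sufficient conditions for equilibrium\<close>

theorem proposition4p1:
  fixes H :: "'i::finite \<Rightarrow> 'a::real_inner set"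
    and K :: "'k::finite set"
    and G :: "'k \<Rightarrow> 'b::real_inner set"
    and \<phi> :: "'i \<Rightarrow> 'a \<Rightarrow> ereal"
    and f :: "'i \<Rightarrow> 'a ^ 'i \<Rightarrow> real"
    and g :: "'k \<Rightarrow> 'b \<Rightarrow> ereal"
    and L :: "'k \<Rightarrow> 'a ^ 'i \<Rightarrow> 'b"
    and x :: "'a ^ 'i"
    and v :: "'b ^ 'k"
  assumes H: "\<And>i. hilbert_space_on (H i)"
    and G: "\<And>k. k \<in> K \<Longrightarrow> hilbert_space_on (G k)"
    and phi: "\<And>i. \<phi> i \<in> Gamma0 (H i)"
    and f_convex: "\<And>i y. y \<in> direct_sum UNIV H \<Longrightarrow>
          convex_on (H i) (\<lambda>z. f i (subst_comp z i y))"
    and f_diff: "\<And>i y. y \<in> direct_sum UNIV H \<Longrightarrow>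
          (\<lambda>z. f i (subst_comp z i y)) differentiable_on H i"
    and G_monotone: "monotone_operator_on (direct_sum UNIV H) (pseudo_gradient H f)"
    and G_lipschitz: "\<exists>C. C-lipschitz_on (direct_sum UNIV H) (pseudo_gradient H f)"
    and g: "\<And>k. k \<in> K \<Longrightarrow> g k \<in> Gamma0 (G k)"
    and L: "\<And>k. k \<in> K \<Longrightarrow> bounded_linear_on (direct_sum UNIV H) (G k) (L k)"
    and x: "x \<in> direct_sum UNIV H"
    and v: "v \<in> direct_sum K G"
    and primal: "\<And>i. - partial_gradient H f i x
            - (\<Sum>k\<in>K. adjoint_on (direct_sum UNIV H) (L k) (v $ k) $ i)
          \<in> subdifferential (H i) (\<phi> i) (x $ i)"
    and dual: "\<And>k. k \<in> K \<Longrightarrow>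
          L k x \<in> subdifferential (G k) (fenchel_conjugate (G k) (g k)) (v $ k)"
  shows "\<forall>i. x $ i \<in> Argmin (H i)
          (\<lambda>y. \<phi> i y + ereal (f i (subst_comp y i x)) + (\<Sum>k\<in>K. g k (L k (subst_comp y i x))))"
proof
  fix i
  let ?S = "direct_sum UNIV H"
  let ?w = "\<lambda>y. subst_comp y i x"
  let ?a = "\<lambda>k. adjoint_on ?S (L k) (v $ k)"
  let ?h = "\<lambda>y. f i (?w y)"
  let ?u = "partial_gradient H f i x"
  let ?F = "\<lambda>y. \<phi> i y + ereal (f i (?w y)) + (\<Sum>k\<in>K. g k (L k (?w y)))"
  have xi: "x $ i \<in> H i" using x by (simp add: direct_sum_def)
  have S: "hilbert_space_on ?S" using H by (rule hilbert_space_on_direct_sum)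
  have "?F (x $ i) \<le> ?F y" if y: "y \<in> H i" for y
  proof -
    let ?c = "\<lambda>k. (y - x $ i) \<bullet> (?a k $ i)"
    have w: "?w y \<in> ?S" using x y by (rule subst_comp_in_direct_sum)
    have f_le: "f i x + (y - x $ i) \<bullet> ?u \<le> ?h y"
      using convex_gradient_inequality[OF H xi y f_convex[OF x]] f_diff[OF x] xi
      by (simp add: partial_gradient_def differentiable_on_def)
    have \<phi>_le: "\<phi> i (x $ i) + ereal (- ((y - x $ i) \<bullet> ?u) - sum ?c K) \<le> \<phi> i y"
      using primal[of i] y
      by (simp add: subdifferential_def inner_diff_right inner_sum_right add.commute)
    have g_le: "g k (L k x) + ereal (?c k) \<le> g k (L k (?w y))" if k: "k \<in> K" for k
    proof -
      have "v $ k \<in> G k" using v k by (simp add: direct_sum_def)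
      then have "v $ k \<in> subdifferential (G k) (g k) (L k x)"
        using subdifferential_conjugate_imp[OF g G _ dual] k by blast
      moreover have "L k (?w y) \<in> G k" using L[OF k] w by (auto simp: bounded_linear_on_def)
      ultimately have "g k (L k x) + ereal ((L k (?w y) - L k x) \<bullet> (v $ k)) \<le> g k (L k (?w y))"
        by (simp add: subdifferential_def add.commute)
      moreover have "(L k (?w y) - L k x) \<bullet> (v $ k) = (?w y - x) \<bullet> ?a k"
        using adjoint_on_works[OF S L[OF k]] w x by (simp add: inner_diff_left)
      ultimately show ?thesis by (simp add: inner_subst_comp_diff)
    qed
    \<comment> \<open>Rewrite the objective at \<open>x\<^sub>i\<close> as the sum of the three lower bounds, whose real slope terms cancel.
      Only real numbers are cancelled, so the \<open>\<phi>\<close> and \<open>g\<close> terms may be infinite.\<close>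
    have "?F (x $ i) = (\<phi> i (x $ i) + ereal (- ((y - x $ i) \<bullet> ?u) - sum ?c K))
        + ereal (f i x + (y - x $ i) \<bullet> ?u) + ((\<Sum>k\<in>K. g k (L k x)) + ereal (sum ?c K))"
    proof -
      have "ereal (f i x) = ereal (- ((y - x $ i) \<bullet> ?u) - sum ?c K)
          + ereal (f i x + (y - x $ i) \<bullet> ?u) + ereal (sum ?c K)" by simp
      then show ?thesis by (simp only: subst_comp_self ac_simps)
    qed
    also have "(\<Sum>k\<in>K. g k (L k x)) + ereal (sum ?c K) = (\<Sum>k\<in>K. g k (L k x) + ereal (?c k))"
      by (simp add: sum.distrib)
    also have "(\<phi> i (x $ i) + ereal (- ((y - x $ i) \<bullet> ?u) - sum ?c K))
        + ereal (f i x + (y - x $ i) \<bullet> ?u) + (\<Sum>k\<in>K. g k (L k x) + ereal (?c k)) \<le> ?F y"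
      using f_le by (intro add_mono \<phi>_le sum_mono g_le) auto
    finally show ?thesis .
  qed
  then show "x $ i \<in> Argmin (H i) ?F"
    using xi by (auto simp: Argmin_def is_arg_min_linorder)
qed

end
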